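(* Let $A\in\mathbb{R}^{n\times d}$ have singular values $\sigma_1\ge\dots\ge\sigma_d>0$, let $1\le k<d$ and $\Delta>0$, and assume that $A$ is $(k,\Delta)$-separated, i.e. $\sigma_k^2-\sigma_{k+1}^2\ge\Delta\sigma_1^2$. Let $0<\varepsilon<1/3$ and let $\tilde A\in\mathbb{R}^{\ell\times d}$ satisfy $$\|A^TA-\tilde A^T\tilde A\|\le\mu\sigma_1^2\quad\text{for }\mu=\varepsilon^2\Delta.$$ Then for every $i\in\{1,\dots,n\}$, $$|T^k(i)-\tilde T^k(i)|\le\varepsilon\|a_{(i)}\|_2^2.$$
   Context: $\|\cdot\|$ is the operator norm; $a_{(i)}\in\mathbb{R}^d$ is the $i$-th row of $A$ as a column vector. Let $A=U\Sigma V^T$ and $\tilde A=\tilde U\tilde\Sigma\tilde V^T$ be SVDs with singular values in non-increasing order, and let $V_k,\tilde V_k\in\mathbb{R}^{d\times k}$ consist of the top $k$ right singular vectors of $A$ and $\tilde A$ respectively. The rank-$k$ projection distance and its estimate are $$T^k(i)=a_{(i)}^T(I-V_kV_k^T)a_{(i)},\qquad \tilde T^k(i)=a_{(i)}^T(I-\tilde V_k\tilde V_k^T)a_{(i)}.$$ *)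

theory Defs
  imports Complex_Main "Jordan_Normal_Form.Matrix"
begin

definition l2_norm :: "real vec \<Rightarrow> real" where
  "l2_norm v = sqrt (v \<bullet> v)"

text \<open>
  The operator norm with respect to the Euclidean norms. The supremum is over a nonempty
  set that is bounded above (lemma \<open>bdd_above_op_norm\<close> below).
\<close>

definition op_norm :: "real mat \<Rightarrow> real" where
  "op_norm M = Sup {l2_norm (M *\<^sub>v x) | x. x \<in> carrier_vec (dim_col M) \<and> l2_norm x \<le> 1}"

text \<open>
  The library predicate \<open>orthogonal_mat\<close> does not normalise the columns, hence the
  explicit conditions on \<open>U\<close> and \<open>V\<close>. \<open>S\<close> has the (possibly rectangular) shape of \<open>A\<close>.
\<close>

definition is_svd :: "real mat \<Rightarrow> real mat \<Rightarrow> real mat \<Rightarrow> real mat \<Rightarrow> bool" where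
  "is_svd A U S V \<longleftrightarrow>
     U \<in> carrier_mat (dim_row A) (dim_row A) \<and>
     S \<in> carrier_mat (dim_row A) (dim_col A) \<and>
     V \<in> carrier_mat (dim_col A) (dim_col A) \<and>
     transpose_mat U * U = 1\<^sub>m (dim_row A) \<and>
     transpose_mat V * V = 1\<^sub>m (dim_col A) \<and>
     diagonal_mat S \<and>
     (\<forall>i < min (dim_row A) (dim_col A). S $$ (i, i) \<ge> 0) \<and>
     (\<forall>i j. i \<le> j \<and> j < min (dim_row A) (dim_col A) \<longrightarrow> S $$ (j, j) \<le> S $$ (i, i)) \<and>
     A = U * S * transpose_mat V"

text \<open>
  The \<open>j\<close>-th singular value, counted from 1, read off the diagonal factor of an SVD.
  Past the end of the diagonal it is 0, so if \<open>S\<close> has \<open>d\<close> columns, then positivity of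
  the \<open>d\<close>-th one forces at least \<open>d\<close> rows.
\<close>

definition sing_val :: "real mat \<Rightarrow> nat \<Rightarrow> real" where
  "sing_val S j =
     (if 1 \<le> j \<and> j \<le> min (dim_row S) (dim_col S) then S $$ (j - 1, j - 1) else 0)"

definition separated :: "real mat \<Rightarrow> nat \<Rightarrow> real \<Rightarrow> bool" where
  "separated S k \<Delta> \<longleftrightarrow> (sing_val S k)\<^sup>2 - (sing_val S (k + 1))\<^sup>2 \<ge> \<Delta> * (sing_val S 1)\<^sup>2"

definition first_cols :: "real mat \<Rightarrow> nat \<Rightarrow> real mat" where
  "first_cols V k = mat (dim_row V) k (\<lambda>(i, j). V $$ (i, j))"

definition proj_dist :: "real mat \<Rightarrow> nat \<Rightarrow> real vec \<Rightarrow> real" where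
  "proj_dist V k a =
     a \<bullet> ((1\<^sub>m (dim_row V) - first_cols V k * transpose_mat (first_cols V k)) *\<^sub>v a)"

lemma abs_index_le_l2_norm:
  assumes "j < dim_vec x"
  shows "\<bar>x $ j\<bar> \<le> l2_norm x"
proof -
  have "(x $ j)\<^sup>2 \<le> (\<Sum>i\<in>{0..<dim_vec x}. x $ i * x $ i)"
    using assms member_le_sum[of j "{0..<dim_vec x}" "\<lambda>i. x $ i * x $ i"]
    by (simp add: power2_eq_square)
  then have "sqrt ((x $ j)\<^sup>2) \<le> l2_norm x"
    unfolding l2_norm_def scalar_prod_def by (rule real_sqrt_le_mono)
  then show ?thesis by simp
qed

lemma bdd_above_op_norm:
  "bdd_above {l2_norm (M *\<^sub>v x) | x. x \<in> carrier_vec (dim_col M) \<and> l2_norm x \<le> 1}"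
proof -
  define B where "B i = (\<Sum>j\<in>{0..<dim_col M}. \<bar>M $$ (i, j)\<bar>)" for i
  have "l2_norm (M *\<^sub>v x) \<le> sqrt (\<Sum>i\<in>{0..<dim_row M}. B i * B i)"
    if x: "x \<in> carrier_vec (dim_col M)" "l2_norm x \<le> 1" for x
  proof -
    have b: "\<bar>(M *\<^sub>v x) $ i\<bar> \<le> B i" if "i < dim_row M" for i
    proof -
      have "(M *\<^sub>v x) $ i = (\<Sum>j\<in>{0..<dim_col M}. M $$ (i, j) * x $ j)"
        using that x by (simp add: scalar_prod_def)
      also have "\<bar>\<dots>\<bar> \<le> (\<Sum>j\<in>{0..<dim_col M}. \<bar>M $$ (i, j) * x $ j\<bar>)"
        by (rule sum_abs)
      also have "\<dots> \<le> B i"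
        unfolding B_def
      proof (rule sum_mono)
        fix j assume "j \<in> {0..<dim_col M}"
        then have "\<bar>x $ j\<bar> \<le> 1"
          using abs_index_le_l2_norm[of j x] x by auto
        then show "\<bar>M $$ (i, j) * x $ j\<bar> \<le> \<bar>M $$ (i, j)\<bar>"
          by (simp add: abs_mult mult_left_le)
      qed
      finally show ?thesis .
    qed
    have "(\<Sum>i\<in>{0..<dim_row M}. (M *\<^sub>v x) $ i * (M *\<^sub>v x) $ i)
        \<le> (\<Sum>i\<in>{0..<dim_row M}. B i * B i)"
    proof (rule sum_mono)
      fix i assume "i \<in> {0..<dim_row M}"
      then have bi: "\<bar>(M *\<^sub>v x) $ i\<bar> \<le> B i" using b by simp
      moreover have "0 \<le> B i" unfolding B_def by (simp add: sum_nonneg)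
      ultimately show "(M *\<^sub>v x) $ i * (M *\<^sub>v x) $ i \<le> B i * B i"
        using mult_mono[OF bi bi] abs_ge_zero by (metis abs_mult_self_eq)
    qed
    then show ?thesis
      unfolding l2_norm_def scalar_prod_def by (simp del: index_mult_mat_vec)
  qed
  then show ?thesis unfolding bdd_above_def by blast
qed

end

theory Submission
  imports Defs "Jordan_Normal_Form.Determinant" "HOL-Analysis.L2_Norm"
begin

text \<open>
  Write \<open>E = A\<^sup>T A - A'\<^sup>T A'\<close> and \<open>W = V\<^sup>T V'\<close>. In the two singular bases \<open>E\<close> becomes the matrix
  \<open>V\<^sup>T E V'\<close> with entries \<open>(\<sigma>\<^sub>j\<^sup>2 - \<sigma>'\<^sub>i\<^sup>2) W\<^sub>j\<^sub>i\<close>. By Weyl's inequality and the gap at \<open>k\<close>, on each of the two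
  off-diagonal blocks of \<open>W\<close> (split at \<open>k\<close>) the spectra stay \<open>g - \<delta>\<close> apart, where
  \<open>g = \<Delta> \<sigma>\<^sub>1\<^sup>2\<close> and \<open>\<delta> = \<epsilon>\<^sup>2 g\<close>, so these blocks have norm at most \<open>\<delta> / (g - \<delta>)\<close>
  (Davis--Kahan). The difference of the two projection distances is a difference of the bilinear
  forms of these blocks, hence at most \<open>2 \<epsilon>\<^sup>2 / (1 - \<epsilon>\<^sup>2) \<le> \<epsilon>\<close> times \<open>\<parallel>a\<parallel>\<^sup>2\<close>.
\<close>

section \<open>Euclidean norm and operator norm\<close>

lemma l2_norm_eq_L2_set: "l2_norm v = L2_set (($) v) {..<dim_vec v}"
  by (simp add: l2_norm_def L2_set_def scalar_prod_def power2_eq_square lessThan_atLeast0)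

lemma l2_norm_nonneg: "0 \<le> l2_norm v"
  by (simp add: l2_norm_eq_L2_set)

lemma l2_norm_sq: "(l2_norm v)\<^sup>2 = v \<bullet> v"
  by (simp add: l2_norm_def scalar_prod_def sum_nonneg)

lemma l2_norm_smult: "l2_norm (c \<cdot>\<^sub>v v) = \<bar>c\<bar> * l2_norm v"
  by (simp add: l2_norm_def real_sqrt_mult flip: mult.assoc power2_eq_square)

lemma abs_scalar_prod_le_l2_norm:
  assumes "dim_vec v = dim_vec w"
  shows "\<bar>v \<bullet> w\<bar> \<le> l2_norm v * l2_norm w"
proof -
  have "\<bar>v \<bullet> w\<bar> \<le> (\<Sum>i<dim_vec w. \<bar>v $ i\<bar> * \<bar>w $ i\<bar>)"
    unfolding scalar_prod_def atLeast0LessThan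
    by (rule order_trans[OF sum_abs]) (simp add: abs_mult)
  also have "\<dots> \<le> l2_norm v * l2_norm w"
    unfolding l2_norm_eq_L2_set assms by (rule L2_set_mult_ineq)
  finally show ?thesis .
qed

text \<open>By homogeneity: a nonzero \<open>x\<close>, rescaled to unit length, enters the set
  whose supremum is \<open>op_norm M\<close>. The zero vector cannot be rescaled and is treated
  apart.\<close>

lemma l2_norm_mult_mat_vec_le:
  assumes "x \<in> carrier_vec (dim_col M)"
  shows "l2_norm (M *\<^sub>v x) \<le> op_norm M * l2_norm x"
proof (cases "l2_norm x = 0")
  case True
  then have "\<And>j. j < dim_vec x \<Longrightarrow> x $ j = 0"
    using abs_index_le_l2_norm[of _ x] by fastforce
  then have "x = 0\<^sub>v (dim_col M)" using assms by auto
  then have "M *\<^sub>v x = 0\<^sub>v (dim_row M)" by auto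
  then show ?thesis using True by (simp add: l2_norm_def)
next
  case False
  let ?c = "l2_norm x"
  let ?y = "inverse ?c \<cdot>\<^sub>v x"
  have c: "?c > 0" using False l2_norm_nonneg[of x] by linarith
  have y: "?y \<in> carrier_vec (dim_col M)" using assms by simp
  have "l2_norm ?y \<le> 1" using c by (simp add: l2_norm_smult)
  then have "l2_norm (M *\<^sub>v ?y) \<le> op_norm M"
    unfolding op_norm_def using y by (intro cSup_upper bdd_above_op_norm) blast
  moreover have "M *\<^sub>v ?y = inverse ?c \<cdot>\<^sub>v (M *\<^sub>v x)"
    using assms by (intro mult_mat_vec) auto
  ultimately show ?thesis using c by (simp add: l2_norm_smult field_simps)
qed

lemma l2_norm_isometry:
  assumes V: "V \<in> carrier_mat m d" "transpose_mat V * V = 1\<^sub>m d" and x: "x \<in> carrier_vec d"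
  shows "l2_norm (V *\<^sub>v x) = l2_norm x"
proof -
  have "(V *\<^sub>v x) \<bullet> (V *\<^sub>v x) = x \<bullet> (transpose_mat V *\<^sub>v (V *\<^sub>v x))"
    using transpose_vec_mult_scalar[OF V(1) x, of "V *\<^sub>v x"] V x
    by (simp add: comm_scalar_prod[of x d])
  also have "transpose_mat V *\<^sub>v (V *\<^sub>v x) = x"
    using V x by (metis assoc_mult_mat_vec one_mult_mat_vec transpose_carrier_mat)
  finally show ?thesis by (simp add: l2_norm_def)
qed

section \<open>Bilinear forms in coordinates: Davis-Kahan and Weyl estimates\<close>

text \<open>There are \<open>j\<close> equations in \<open>j + 1\<close> unknowns. Padding the
  system with a zero row makes it square and singular, and a kernel vector gives \<open>c\<close>.
  Extending \<open>c\<close> by zero lets it serve as a coordinate vector over a longer index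
  range.\<close>

lemma ex_nontrivial_kernel:
  fixes W :: "nat \<Rightarrow> nat \<Rightarrow> real"
  obtains c where "\<And>i. i > j \<Longrightarrow> c i = 0" "\<exists>i\<le>j. c i \<noteq> 0"
    "\<And>i. i < j \<Longrightarrow> (\<Sum>m\<le>j. W m i * c m) = 0"
proof -
  define M where "M = mat (Suc j) (Suc j) (\<lambda>(i, m). if i < j then W m i else 0)"
  have M: "M \<in> carrier_mat (Suc j) (Suc j)" by (simp add: M_def)
  have "M = mat\<^sub>r (Suc j) (Suc j) (\<lambda>i. if i = j then 0\<^sub>v (Suc j) else row M i)"
    by (rule eq_matI) (auto simp: M_def)
  also have "det \<dots> = 0" using M by (intro det_row_0) auto
  finally have "det M = 0" .
  then obtain v where v: "v \<in> carrier_vec (Suc j)" "v \<noteq> 0\<^sub>v (Suc j)" "M *\<^sub>v v = 0\<^sub>v (Suc j)"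
    using det_0_iff_vec_prod_zero[OF M] by blast
  show thesis
  proof (rule that[of "\<lambda>i. if i \<le> j then v $ i else 0"])
    show "\<exists>i\<le>j. (if i \<le> j then v $ i else 0) \<noteq> 0"
    proof (rule ccontr)
      assume "\<not> ?thesis"
      then have "v = 0\<^sub>v (Suc j)" using v(1) by (intro eq_vecI) auto
      with v(2) show False by simp
    qed
  next
    fix i assume i: "i < j"
    have "(M *\<^sub>v v) $ i = 0" using v(3) i by simp
    moreover have "(M *\<^sub>v v) $ i = (\<Sum>m<Suc j. M $$ (i, m) * v $ m)"
      using v(1) i M by (simp add: scalar_prod_def lessThan_atLeast0)
    moreover have "\<dots> = (\<Sum>m\<le>j. W m i * (if m \<le> j then v $ m else 0))"
      unfolding lessThan_Suc_atMost by (rule sum.cong) (use i in \<open>auto simp: M_def\<close>)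
    ultimately show "(\<Sum>m\<le>j. W m i * (if m \<le> j then v $ m else 0)) = 0" by simp
  qed simp
qed

text \<open>
  From \<open>\<alpha>\<^sub>j W\<^sub>j\<^sub>i = (\<alpha>\<^sub>j - \<beta>\<^sub>i) W\<^sub>j\<^sub>i + W\<^sub>j\<^sub>i \<beta>\<^sub>i\<close>, any bound \<open>c\<close> on the norm of \<open>W\<close> improves to
  \<open>(\<delta> + r c) / t\<close>; apply this to the least bound.
\<close>

lemma sylvester_bound:
  fixes W :: "'a \<Rightarrow> 'b \<Rightarrow> real"
  assumes fin: "finite J" "finite I"
    and bound: "\<And>x y. \<bar>\<Sum>j\<in>J. \<Sum>i\<in>I. x j * ((\<alpha> j - \<beta> i) * W j i) * y i\<bar> \<le> \<delta> * L2_set x J * L2_set y I"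
    and \<alpha>: "\<And>j. j \<in> J \<Longrightarrow> t \<le> \<alpha> j"
    and \<beta>: "\<And>i. i \<in> I \<Longrightarrow> \<bar>\<beta> i\<bar> \<le> r"
    and rt: "0 \<le> r" "r < t" and \<delta>: "0 \<le> \<delta>"
  shows "\<bar>\<Sum>j\<in>J. \<Sum>i\<in>I. x j * W j i * y i\<bar> \<le> \<delta> / (t - r) * L2_set x J * L2_set y I"
proof -
  define F where "F x y = (\<Sum>j\<in>J. \<Sum>i\<in>I. x j * W j i * y i)" for x y
  \<comment> \<open>The admissible bounds on the norm of the form; the infimum of this set is the
    norm itself.\<close>
  define C where "C = {c. 0 \<le> c \<and> (\<forall>x y. \<bar>F x y\<bar> \<le> c * L2_set x J * L2_set y I)}"
  have improve: "(\<delta> + r * c) / t \<in> C" if "c \<in> C" for c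
  proof -
    have c: "0 \<le> c" "\<bar>F x y\<bar> \<le> c * L2_set x J * L2_set y I" for x y
      using that by (auto simp: C_def)
    have "\<bar>F x y\<bar> \<le> (\<delta> + r * c) / t * L2_set x J * L2_set y I" for x y
    proof -
      \<comment> \<open>The identity is divided by \<open>\<alpha> j\<close>: \<open>x'\<close>
        absorbs this factor and shrinks by at least \<open>t\<close>, while \<open>y'\<close>
        absorbs \<open>\<beta> i\<close> and grows by at most \<open>r\<close>.\<close>
      define x' where "x' j = x j / \<alpha> j" for j
      define y' where "y' i = \<beta> i * y i" for i
      have "F x y = (\<Sum>j\<in>J. \<Sum>i\<in>I. x' j * ((\<alpha> j - \<beta> i) * W j i) * y i) + F x' y'"
        unfolding F_def sum.distrib[symmetric]
      proof (intro sum.cong refl)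
        fix j i assume "j \<in> J"
        then have "\<alpha> j \<noteq> 0" using \<alpha> rt by force
        then show "x j * W j i * y i = x' j * ((\<alpha> j - \<beta> i) * W j i) * y i + x' j * W j i * y' i"
          by (simp add: x'_def y'_def field_simps)
      qed
      then have "\<bar>F x y\<bar> \<le> \<delta> * L2_set x' J * L2_set y I + c * L2_set x' J * L2_set y' I"
        using bound[of x' y] c(2)[of x' y'] by linarith
      also have "L2_set y' I \<le> r * L2_set y I"
      proof -
        have "L2_set y' I \<le> L2_set (\<lambda>i. r * \<bar>y i\<bar>) I"
          unfolding L2_set_def y'_def using \<beta> rt
          by (intro real_sqrt_le_mono sum_mono)
             (metis abs_ge_zero abs_mult mult_mono order_refl power2_abs power_mono rt(1))
        also have "\<dots> = r * L2_set y I"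
          using rt by (simp add: L2_set_right_distrib[symmetric]) (simp add: L2_set_def)
        finally show ?thesis .
      qed
      also have "L2_set x' J \<le> L2_set x J / t"
      proof -
        have "L2_set x' J \<le> L2_set (\<lambda>j. (1 / t) * \<bar>x j\<bar>) J"
          unfolding L2_set_def
        proof (intro real_sqrt_le_mono sum_mono)
          fix j assume "j \<in> J"
          then have "t \<le> \<alpha> j" by (rule \<alpha>)
          then have "\<bar>x' j\<bar> \<le> 1 / t * \<bar>x j\<bar>"
            unfolding x'_def using rt by (simp add: abs_divide frac_le)
          then show "(x' j)\<^sup>2 \<le> (1 / t * \<bar>x j\<bar>)\<^sup>2"
            by (metis abs_ge_zero power2_abs power_mono)
        qed
        also have "\<dots> = 1 / t * L2_set x J"
          using rt by (subst L2_set_right_distrib[symmetric]) (auto simp: L2_set_def)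
        finally show ?thesis by simp
      qed
      finally show ?thesis
        using rt \<delta> c by (simp add: field_simps mult_left_mono mult_right_mono add_mono)
    qed
    then show ?thesis using c rt \<delta> by (simp add: C_def)
  qed
  \<comment> \<open>A crude bound suffices here: it only makes \<open>C\<close> nonempty, so that
    its infimum is meaningful.\<close>
  have "(\<Sum>j\<in>J. \<Sum>i\<in>I. \<bar>W j i\<bar>) \<in> C"
  proof -
    have "\<bar>F x y\<bar> \<le> (\<Sum>j\<in>J. \<Sum>i\<in>I. \<bar>W j i\<bar>) * L2_set x J * L2_set y I" for x y
    proof -
      have "\<bar>F x y\<bar> \<le> (\<Sum>j\<in>J. \<Sum>i\<in>I. \<bar>x j * W j i * y i\<bar>)"
        unfolding F_def by (intro order_trans[OF sum_abs] sum_mono sum_abs)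
      also have "\<dots> \<le> (\<Sum>j\<in>J. \<Sum>i\<in>I. \<bar>W j i\<bar> * (L2_set x J * L2_set y I))"
      proof (intro sum_mono)
        fix j i assume ji: "j \<in> J" "i \<in> I"
        have "\<bar>x j\<bar> \<le> L2_set (\<lambda>j. \<bar>x j\<bar>) J" "\<bar>y i\<bar> \<le> L2_set (\<lambda>i. \<bar>y i\<bar>) I"
          using ji fin by (auto intro: member_le_L2_set)
        then have "\<bar>x j\<bar> * \<bar>y i\<bar> \<le> L2_set x J * L2_set y I"
          by (intro mult_mono) (auto simp: L2_set_def sum_nonneg)
        then show "\<bar>x j * W j i * y i\<bar> \<le> \<bar>W j i\<bar> * (L2_set x J * L2_set y I)"
          using mult_left_mono[of _ _ "\<bar>W j i\<bar>"] by (fastforce simp: abs_mult ac_simps)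
      qed
      finally show ?thesis by (simp add: sum_distrib_right mult.assoc)
    qed
    then show ?thesis by (simp add: C_def sum_nonneg)
  qed
  then have ne: "C \<noteq> {}" by blast
  have bdd: "bdd_below C" by (auto simp: C_def)
  define s where "s = Inf C"
  have s0: "0 \<le> s" unfolding s_def using ne by (intro cInf_greatest) (auto simp: C_def)
  \<comment> \<open>The infimum is itself a bound. Dividing by the product of the norms shows this
    unless that product vanishes, and then every bound reads the same.\<close>
  have sb: "\<bar>F x y\<bar> \<le> s * L2_set x J * L2_set y I" for x y
  proof (cases "L2_set x J * L2_set y I = 0")
    case True
    obtain c where "\<bar>F x y\<bar> \<le> c * L2_set x J * L2_set y I" using ne by (auto simp: C_def)
    then show ?thesis using True by (simp add: mult.assoc del: mult_eq_0_iff)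
  next
    case False
    then have p: "L2_set x J * L2_set y I > 0" by (simp add: less_le)
    have "\<bar>F x y\<bar> / (L2_set x J * L2_set y I) \<le> s"
      unfolding s_def using ne p by (intro cInf_greatest) (auto simp: C_def divide_le_eq mult.assoc)
    then show ?thesis using p by (simp add: divide_le_eq mult.assoc)
  qed
  have "s \<in> C" using s0 sb by (simp add: C_def)
  \<comment> \<open>The improved bound cannot fall below the least one; solving for \<open>s\<close>
    uses \<open>r < t\<close>.\<close>
  then have "s \<le> (\<delta> + r * s) / t"
    unfolding s_def using bdd improve by (intro cInf_lower) (auto simp: s_def)
  then have "s \<le> \<delta> / (t - r)" using rt by (simp add: field_simps)
  then have "s * (L2_set x J * L2_set y I) \<le> \<delta> / (t - r) * (L2_set x J * L2_set y I)"
    by (intro mult_right_mono) auto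
  then show ?thesis using sb[of x y] by (simp add: F_def mult.assoc)
qed

text \<open>
  Test the form on a vector of the span of the first \<open>m + 1\<close> basis vectors on the \<open>\<alpha>\<close> side that
  is orthogonal to the first \<open>m\<close> basis vectors on the \<open>\<beta>\<close> side.
\<close>

lemma weyl_le:
  fixes W :: "nat \<Rightarrow> nat \<Rightarrow> real"
  assumes orth: "\<And>j m. j < d \<Longrightarrow> m < d \<Longrightarrow> (\<Sum>i<d. W j i * W m i) = (if j = m then 1 else 0)"
    and bound: "\<And>x y. \<bar>\<Sum>j<d. \<Sum>i<d. x j * ((\<alpha> j - \<beta> i) * W j i) * y i\<bar>
        \<le> \<delta> * L2_set x {..<d} * L2_set y {..<d}"
    and \<alpha>: "\<And>i j. i \<le> j \<Longrightarrow> j < d \<Longrightarrow> \<alpha> j \<le> \<alpha> i"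
    and \<beta>: "\<And>i j. i \<le> j \<Longrightarrow> j < d \<Longrightarrow> \<beta> j \<le> \<beta> i"
    and m: "m < d"
  shows "\<alpha> m \<le> \<beta> m + \<delta>"
proof -
  obtain c where c: "\<And>i. i > m \<Longrightarrow> c i = 0" "\<exists>i\<le>m. c i \<noteq> 0"
    "\<And>i. i < m \<Longrightarrow> (\<Sum>j\<le>m. W j i * c j) = 0"
    using ex_nontrivial_kernel[of m W] by blast
  \<comment> \<open>\<open>c\<close> and \<open>p\<close> are the coordinates of one vector in the
    two bases: \<open>p\<close> is the transpose of \<open>W\<close> applied to \<open>c\<close>,
    and orthonormal rows give \<open>c\<close> back from \<open>p\<close>.\<close>
  define p where "p i = (\<Sum>j<d. W j i * c j)" for i
  have p0: "p i = 0" if "i < m" for i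
  proof -
    have "p i = (\<Sum>j\<le>m. W j i * c j)"
      unfolding p_def using m c(1) by (intro sum.mono_neutral_right) (auto simp: not_le)
    then show ?thesis using c(3)[OF that] by simp
  qed
  have Wp: "(\<Sum>i<d. W j i * p i) = c j" if "j < d" for j
  proof -
    have "(\<Sum>i<d. W j i * p i) = (\<Sum>i<d. \<Sum>n<d. W j i * W n i * c n)"
      by (simp add: p_def sum_distrib_left ac_simps)
    also have "\<dots> = (\<Sum>n<d. (\<Sum>i<d. W j i * W n i) * c n)"
      by (subst sum.swap) (simp add: sum_distrib_right)
    also have "\<dots> = (\<Sum>n<d. if n = j then c n else 0)"
      using that by (intro sum.cong) (auto simp: orth)
    also have "\<dots> = c j" using that by simp
    finally show ?thesis .
  qed
  have a: "(\<Sum>j<d. \<Sum>i<d. c j * (\<alpha> j * W j i) * p i) = (\<Sum>j<d. \<alpha> j * (c j)\<^sup>2)"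
  proof (intro sum.cong refl)
    fix j assume "j \<in> {..<d}"
    have "(\<Sum>i<d. c j * (\<alpha> j * W j i) * p i) = c j * \<alpha> j * (\<Sum>i<d. W j i * p i)"
      by (simp add: sum_distrib_left ac_simps)
    then show "(\<Sum>i<d. c j * (\<alpha> j * W j i) * p i) = \<alpha> j * (c j)\<^sup>2"
      using Wp \<open>j \<in> {..<d}\<close> by (simp add: power2_eq_square)
  qed
  have b: "(\<Sum>j<d. \<Sum>i<d. c j * (f i * W j i) * p i) = (\<Sum>i<d. f i * (p i)\<^sup>2)" for f
  proof -
    have "(\<Sum>j<d. c j * (f i * W j i) * p i) = f i * (p i)\<^sup>2" for i
    proof -
      have "(\<Sum>j<d. c j * (f i * W j i) * p i) = f i * p i * (\<Sum>j<d. W j i * c j)"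
        by (simp add: sum_distrib_left ac_simps)
      then show ?thesis by (simp add: p_def power2_eq_square)
    qed
    then show ?thesis by (subst sum.swap) simp
  qed
  \<comment> \<open>The common squared norm of \<open>c\<close> and \<open>p\<close>.\<close>
  define N where "N = (\<Sum>j<d. (c j)\<^sup>2)"
  have N: "N = (\<Sum>i<d. (p i)\<^sup>2)"
  proof -
    have "(\<Sum>i<d. (p i)\<^sup>2) = (\<Sum>j<d. c j * (\<Sum>i<d. W j i * p i))"
      using b[of "\<lambda>_. 1"] by (simp add: sum_distrib_left ac_simps)
    then show ?thesis unfolding N_def using Wp by (simp add: power2_eq_square)
  qed
  obtain i where "i \<le> m" "c i \<noteq> 0" using c(2) by blast
  then have Npos: "N > 0"
    unfolding N_def using m by (intro sum_pos2[of _ i]) auto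
  \<comment> \<open>At the pair \<open>c\<close>, \<open>p\<close> the form is the difference of the
    two diagonal quadratic forms at the same vector.\<close>
  have "(\<Sum>j<d. \<Sum>i<d. c j * ((\<alpha> j - \<beta> i) * W j i) * p i)
      = (\<Sum>j<d. \<alpha> j * (c j)\<^sup>2) - (\<Sum>i<d. \<beta> i * (p i)\<^sup>2)"
    unfolding a[symmetric] b[symmetric] sum_subtractf[symmetric] by (simp add: algebra_simps)
  moreover have "\<delta> * L2_set c {..<d} * L2_set p {..<d} = \<delta> * N"
    unfolding L2_set_def N[symmetric] N_def[symmetric] using Npos by simp
  ultimately have "(\<Sum>j<d. \<alpha> j * (c j)\<^sup>2) - (\<Sum>i<d. \<beta> i * (p i)\<^sup>2) \<le> \<delta> * N"
    using bound[of c p] by linarith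
  \<comment> \<open>\<open>c\<close> is supported on indices up to \<open>m\<close>, where \<alpha>
    is at least \<open>\<alpha> m\<close>; \<open>p\<close> is supported on indices from
    \<open>m\<close> on, where \<beta> is at most \<open>\<beta> m\<close>.\<close>
  moreover have "\<alpha> m * N \<le> (\<Sum>j<d. \<alpha> j * (c j)\<^sup>2)"
    unfolding N_def sum_distrib_left
  proof (intro sum_mono)
    fix j assume "j \<in> {..<d}"
    then show "\<alpha> m * (c j)\<^sup>2 \<le> \<alpha> j * (c j)\<^sup>2"
      using c(1)[of j] \<alpha>[of j m] m by (cases "j \<le> m") (auto intro: mult_right_mono)
  qed
  moreover have "(\<Sum>i<d. \<beta> i * (p i)\<^sup>2) \<le> \<beta> m * N"
    unfolding N sum_distrib_left
  proof (intro sum_mono)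
    fix j assume "j \<in> {..<d}"
    then show "\<beta> j * (p j)\<^sup>2 \<le> \<beta> m * (p j)\<^sup>2"
      using p0[of j] \<beta>[of m j] by (cases "j < m") (auto intro: mult_right_mono)
  qed
  ultimately have "\<alpha> m * N \<le> (\<beta> m + \<delta>) * N" by (simp add: algebra_simps)
  then show ?thesis using Npos by simp
qed


text \<open>Exchanging the two bases only changes the sign of the form. This allows the Weyl and
  Davis-Kahan estimates to be applied a second time with \<alpha> and \<beta> interchanged.\<close>

lemma bilinear_bound_flip:
  fixes W :: "nat \<Rightarrow> nat \<Rightarrow> real"
  assumes "\<And>x y. \<bar>\<Sum>j<d. \<Sum>i<d. x j * ((\<alpha> j - \<beta> i) * W j i) * y i\<bar>
        \<le> \<delta> * L2_set x {..<d} * L2_set y {..<d}"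
  shows "\<bar>\<Sum>i<d. \<Sum>j<d. y i * ((\<beta> i - \<alpha> j) * W j i) * x j\<bar>
        \<le> \<delta> * L2_set y {..<d} * L2_set x {..<d}"
proof -
  have "(\<Sum>i<d. \<Sum>j<d. y i * ((\<beta> i - \<alpha> j) * W j i) * x j)
      = - (\<Sum>j<d. \<Sum>i<d. x j * ((\<alpha> j - \<beta> i) * W j i) * y i)"
    by (subst sum.swap) (simp add: sum_negf[symmetric] algebra_simps)
  then show ?thesis using assms[of x y] by (simp add: ac_simps)
qed

text \<open>Extending \<open>x\<close> and \<open>y\<close> by zero outside \<open>J\<close> and
  \<open>I\<close> changes neither the value of the form nor the norms.\<close>

lemma bilinear_bound_restrict:
  fixes G :: "nat \<Rightarrow> nat \<Rightarrow> real"
  assumes bound: "\<And>x y. \<bar>\<Sum>j<d. \<Sum>i<d. x j * G j i * y i\<bar>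
        \<le> \<delta> * L2_set x {..<d} * L2_set y {..<d}"
    and J: "J \<subseteq> {..<d}" and I: "I \<subseteq> {..<d}"
  shows "\<bar>\<Sum>j\<in>J. \<Sum>i\<in>I. x j * G j i * y i\<bar> \<le> \<delta> * L2_set x J * L2_set y I"
proof -
  define x' where "x' = (\<lambda>j. if j \<in> J then x j else 0)"
  define y' where "y' = (\<lambda>i. if i \<in> I then y i else 0)"
  have "(\<Sum>i<d. x' j * G j i * y' i) = (\<Sum>i\<in>I. x' j * G j i * y i)" for j
    using I by (intro sum.mono_neutral_cong_right) (auto simp: y'_def)
  moreover have "(\<Sum>j<d. \<Sum>i\<in>I. x' j * G j i * y i) = (\<Sum>j\<in>J. \<Sum>i\<in>I. x j * G j i * y i)"
    using J by (subst sum.mono_neutral_cong_right[of "{..<d}" J]) (auto simp: x'_def)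
  moreover have "L2_set (\<lambda>i. if i \<in> K then z i else 0) {..<d} = L2_set z K"
    if "K \<subseteq> {..<d}" for K and z :: "nat \<Rightarrow> real"
    unfolding L2_set_def using that
    by (intro arg_cong[of _ _ sqrt] sum.mono_neutral_cong_right) auto
  then have "L2_set x' {..<d} = L2_set x J" "L2_set y' {..<d} = L2_set y I"
    using J I by (simp_all add: x'_def y'_def)
  ultimately show ?thesis using bound[of x' y'] by simp
qed

section \<open>Difference of squared projections through off-diagonal blocks\<close>

text \<open>\<open>p\<close> and \<open>q\<close> are the coordinates of one vector in the two
  bases. Expanding one factor of each square in the other basis turns both sums into sums of
  \<open>p j * W j i * q i\<close>. The common block with both indices below \<open>k\<close>
  cancels, and each of the two remaining blocks contributes
  \<open>\<delta> / (g - \<delta>)\<close>.\<close>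

lemma projection_difference_bound:
  fixes W :: "nat \<Rightarrow> nat \<Rightarrow> real"
  assumes rows: "\<And>j m. j < d \<Longrightarrow> m < d \<Longrightarrow> (\<Sum>i<d. W j i * W m i) = (if j = m then 1 else 0)"
    and cols: "\<And>j m. j < d \<Longrightarrow> m < d \<Longrightarrow> (\<Sum>i<d. W i j * W i m) = (if j = m then 1 else 0)"
    and bound: "\<And>x y. \<bar>\<Sum>j<d. \<Sum>i<d. x j * ((\<alpha> j - \<beta> i) * W j i) * y i\<bar>
        \<le> \<delta> * L2_set x {..<d} * L2_set y {..<d}"
    and \<alpha>: "\<And>i j. i \<le> j \<Longrightarrow> j < d \<Longrightarrow> \<alpha> j \<le> \<alpha> i" "\<And>i. 0 \<le> \<alpha> i"
    and \<beta>: "\<And>i j. i \<le> j \<Longrightarrow> j < d \<Longrightarrow> \<beta> j \<le> \<beta> i" "\<And>i. 0 \<le> \<beta> i"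
    and k: "1 \<le> k" "k < d"
    and gap: "g \<le> \<alpha> (k - 1) - \<alpha> k" and \<delta>: "0 \<le> \<delta>" "\<delta> < g"
    and p: "\<And>j. j < d \<Longrightarrow> p j = (\<Sum>i<d. W j i * q i)"
    and q: "\<And>i. i < d \<Longrightarrow> q i = (\<Sum>j<d. W j i * p j)"
  shows "\<bar>(\<Sum>j<k. (p j)\<^sup>2) - (\<Sum>i<k. (q i)\<^sup>2)\<bar>
    \<le> 2 * (\<delta> / (g - \<delta>)) * L2_set p {..<d} * L2_set q {..<d}"
proof -
  define s where "s = \<delta> / (g - \<delta>)"
  define f where "f j i = p j * W j i * q i" for j i
  note flip = bilinear_bound_flip[OF bound]
  \<comment> \<open>Weyl's inequality turns the gap of \<alpha> into mixed gaps: both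
    \<open>\<alpha> (k - 1) - \<beta> k\<close> and \<open>\<beta> (k - 1) - \<alpha> k\<close> are
    at least \<open>g - \<delta>\<close>. Indices start at 0, so the gap lies between
    \<open>k - 1\<close> and \<open>k\<close>.\<close>
  have wk: "\<alpha> (k - 1) \<le> \<beta> (k - 1) + \<delta>"
    using weyl_le[OF rows bound \<alpha>(1) \<beta>(1)] k by simp
  have wk': "\<beta> k \<le> \<alpha> k + \<delta>"
    using weyl_le[where W = "\<lambda>i j. W j i", OF cols flip \<beta>(1) \<alpha>(1)] k by simp
  have s: "\<delta> / (t - r) \<le> s" if "g - \<delta> \<le> t - r" for t r
    unfolding s_def using that \<delta> by (intro divide_left_mono) auto
  have mono: "L2_set x J \<le> L2_set x {..<d}" if "J \<subseteq> {..<d}" for x :: "nat \<Rightarrow> real" and J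
    unfolding L2_set_def using that by (intro real_sqrt_le_mono sum_mono2) auto
  \<comment> \<open>Brings both block estimates to one form: the denominator shrinks to
    \<open>g - \<delta>\<close> and the norms extend to all coordinates.\<close>
  have le: "\<delta> / (t - r) * L2_set x J * L2_set y I \<le> s * L2_set x {..<d} * L2_set y {..<d}"
    if "g - \<delta> \<le> t - r" "J \<subseteq> {..<d}" "I \<subseteq> {..<d}" for t r J I and x y :: "nat \<Rightarrow> real"
    using that s mono \<delta> by (intro mult_mono) (auto simp: s_def)
  have b1: "\<bar>\<Sum>j\<in>{..<k}. \<Sum>i\<in>{k..<d}. f j i\<bar> \<le> s * L2_set p {..<d} * L2_set q {..<d}"
  proof -
    have sub: "{..<k} \<subseteq> {..<d}" "{k..<d} \<subseteq> {..<d}" using k by auto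
    have "\<bar>\<Sum>j\<in>{..<k}. \<Sum>i\<in>{k..<d}. f j i\<bar>
        \<le> \<delta> / (\<alpha> (k - 1) - \<beta> k) * L2_set p {..<k} * L2_set q {k..<d}"
      unfolding f_def
    \<comment> \<open>Here \<open>t\<close> is \<open>\<alpha> (k - 1)\<close> and \<open>r\<close>
      is \<open>\<beta> k\<close>; nonnegativity of \<beta> turns its monotonicity into a bound on
      absolute values.\<close>
    proof (rule sylvester_bound[where \<alpha> = \<alpha> and \<beta> = \<beta>])
      show "\<alpha> (k - 1) \<le> \<alpha> j" if "j \<in> {..<k}" for j using that k by (intro \<alpha>(1)) auto
      show "\<bar>\<beta> i\<bar> \<le> \<beta> k" if "i \<in> {k..<d}" for i using that \<beta> by auto
    qed (use bilinear_bound_restrict[OF bound sub] \<beta>(2) \<delta> gap wk' in auto)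
    also have "\<dots> \<le> s * L2_set p {..<d} * L2_set q {..<d}"
      using gap wk' sub by (intro le) auto
    finally show ?thesis .
  qed
  have b2: "\<bar>\<Sum>i\<in>{..<k}. \<Sum>j\<in>{k..<d}. f j i\<bar> \<le> s * L2_set q {..<d} * L2_set p {..<d}"
  proof -
    have sub: "{..<k} \<subseteq> {..<d}" "{k..<d} \<subseteq> {..<d}" using k by auto
    have "\<bar>\<Sum>i\<in>{..<k}. \<Sum>j\<in>{k..<d}. q i * W j i * p j\<bar>
        \<le> \<delta> / (\<beta> (k - 1) - \<alpha> k) * L2_set q {..<k} * L2_set p {k..<d}"
    \<comment> \<open>The mirrored block: the large values now come from \<beta>, the small ones
      from \<alpha>, and \<open>W\<close> is transposed.\<close>
    proof (rule sylvester_bound[where \<alpha> = \<beta> and \<beta> = \<alpha> and W = "\<lambda>i j. W j i"])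
      show "\<beta> (k - 1) \<le> \<beta> j" if "j \<in> {..<k}" for j using that k by (intro \<beta>(1)) auto
      show "\<bar>\<alpha> i\<bar> \<le> \<alpha> k" if "i \<in> {k..<d}" for i using that \<alpha> by auto
    qed (use bilinear_bound_restrict[OF flip sub] \<alpha>(2) \<delta> gap wk in auto)
    also have "\<dots> \<le> s * L2_set q {..<d} * L2_set p {..<d}"
      using gap wk sub by (intro le) auto
    finally show ?thesis by (simp add: f_def ac_simps)
  qed
  have split: "(\<Sum>m<d. h m) = (\<Sum>m<k. h m) + (\<Sum>m=k..<d. h m)" for h :: "nat \<Rightarrow> real"
    using k sum.atLeastLessThan_concat[of 0 k d h] by (simp add: lessThan_atLeast0)
  have "(\<Sum>j<k. (p j)\<^sup>2) = (\<Sum>j<k. \<Sum>i<d. f j i)"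
  proof (intro sum.cong refl)
    fix j assume "j \<in> {..<k}"
    then have "(p j)\<^sup>2 = p j * (\<Sum>i<d. W j i * q i)"
      using k p[of j] by (simp add: power2_eq_square)
    then show "(p j)\<^sup>2 = (\<Sum>i<d. f j i)" by (simp add: f_def sum_distrib_left ac_simps)
  qed
  moreover have "(\<Sum>i<k. (q i)\<^sup>2) = (\<Sum>i<k. \<Sum>j<d. f j i)"
  proof (intro sum.cong refl)
    fix i assume "i \<in> {..<k}"
    then have "(q i)\<^sup>2 = q i * (\<Sum>j<d. W j i * p j)"
      using k q[of i] by (simp add: power2_eq_square)
    then show "(q i)\<^sup>2 = (\<Sum>j<d. f j i)" by (simp add: f_def sum_distrib_left ac_simps)
  qed
  \<comment> \<open>This is the block that cancels in the difference.\<close>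
  moreover have "(\<Sum>j<k. \<Sum>i<k. f j i) = (\<Sum>i<k. \<Sum>j<k. f j i)" by (rule sum.swap)
  ultimately have "(\<Sum>j<k. (p j)\<^sup>2) - (\<Sum>i<k. (q i)\<^sup>2)
      = (\<Sum>j<k. \<Sum>i=k..<d. f j i) - (\<Sum>i<k. \<Sum>j=k..<d. f j i)"
    by (simp add: split sum.distrib)
  then show ?thesis using b1 b2 unfolding s_def[symmetric] by (simp add: ac_simps)
qed

section \<open>Singular value decompositions and projection distances in coordinates\<close>

lemma transpose_mult_diagonal:
  assumes S: "S \<in> carrier_mat n d" "diagonal_mat S"
  shows "transpose_mat S * S
    = mat d d (\<lambda>(i, j). if i = j then (sing_val S (Suc i))\<^sup>2 else (0 :: real))" (is "_ = ?D")
proof (rule eq_matI)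
  fix i j assume "i < dim_row ?D" "j < dim_col ?D"
  then have ij: "i < d" "j < d" by auto
  have "(transpose_mat S * S) $$ (i, j) = (\<Sum>m<n. S $$ (m, i) * S $$ (m, j))"
    using S ij by (simp add: scalar_prod_def lessThan_atLeast0)
  \<comment> \<open>For \<open>i \<ge> n\<close> no row index equals \<open>i\<close> and the sum is
    0, which agrees with the default value of \<open>sing_val\<close> past the diagonal.\<close>
  also have "\<dots> = (\<Sum>m<n. if m = i then (if i = j then (S $$ (i, i))\<^sup>2 else 0) else 0)"
    using S ij by (intro sum.cong) (auto simp: diagonal_mat_def power2_eq_square)
  also have "\<dots> = ?D $$ (i, j)"
    using S ij by (auto simp: sing_val_def)
  finally show "(transpose_mat S * S) $$ (i, j) = ?D $$ (i, j)" .
qed (use S in auto)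

text \<open>Two forms of the eigenvector relation for the Gram matrix. The commutation of \<Sigma>
  and \<Sigma>' past \<open>W\<close> in the perturbation bound takes the left form for
  \<open>A\<close> and the right form for \<open>A'\<close>.\<close>

lemma svd_gram:
  assumes A: "A \<in> carrier_mat n d" and svd: "is_svd A U S V"
  defines "D \<equiv> mat d d (\<lambda>(i, j). if i = j then (sing_val S (Suc i))\<^sup>2 else (0 :: real))"
  shows "transpose_mat A * A * V = V * D"
    and "transpose_mat V * (transpose_mat A * A) = D * transpose_mat V"
proof -
  have U: "U \<in> carrier_mat n n" "transpose_mat U * U = 1\<^sub>m n"
    and S: "S \<in> carrier_mat n d" "diagonal_mat S"
    and V: "V \<in> carrier_mat d d" "transpose_mat V * V = 1\<^sub>m d"
    and eq: "A = U * S * transpose_mat V"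
    using A svd by (auto simp: is_svd_def)
  have D: "D \<in> carrier_mat d d" by (simp add: D_def)
  have SD: "transpose_mat S * S = D" using transpose_mult_diagonal[OF S] by (simp add: D_def)
  have AV: "A * V = U * S"
    unfolding eq using U S V
    by (simp add: assoc_mult_mat[of _ n d _ d _ d] assoc_mult_mat[of _ n n _ d _ d])
  have "transpose_mat A * U = V * transpose_mat S"
  proof -
    have "transpose_mat A = V * (transpose_mat S * transpose_mat U)"
      unfolding eq using U S V
      by (simp add: transpose_mult[of _ n d _ d] transpose_mult[of _ n n _ d])
    then show ?thesis using U S V
      by (simp add: assoc_mult_mat[of _ d d _ n _ n] assoc_mult_mat[of _ d n _ n _ n])
  qed
  then have "transpose_mat A * (U * S) = V * (transpose_mat S * S)"
    using A U S V
    by (simp add: assoc_mult_mat[of _ d n _ n _ d, symmetric] assoc_mult_mat[of _ d d _ n _ d])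
  then show 1: "transpose_mat A * A * V = V * D"
    using A V AV SD by (simp add: assoc_mult_mat[of _ d n _ d _ d])
  \<comment> \<open>The second relation is the transpose of the first, since the Gram matrix and
    \<open>D\<close> are symmetric.\<close>
  have "transpose_mat (transpose_mat A * A * V) = transpose_mat V * (transpose_mat A * A)"
    using A V by (simp add: transpose_mult[of _ n d _ d] transpose_mult[of _ d n _ d] assoc_mult_mat[of _ d d _ n _ d])
  moreover have "transpose_mat (V * D) = D * transpose_mat V"
  proof -
    have "transpose_mat D = D" by (rule eq_matI) (auto simp: D_def)
    then show ?thesis using V D by (simp add: transpose_mult[of _ d d _ d])
  qed
  ultimately show "transpose_mat V * (transpose_mat A * A) = D * transpose_mat V"
    using 1 by simp
qed

text \<open>The form is the inner product of \<open>V *\<^sub>v u\<close> with \<open>E\<close>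
  applied to \<open>V' *\<^sub>v v\<close>, where \<open>u\<close>, \<open>v\<close> have entries
  \<open>x\<close>, \<open>y\<close> and \<open>E\<close> is the difference of the Gram matrices.
  Cauchy-Schwarz and the operator norm bound it, and \<open>V\<close>, \<open>V'\<close> preserve
  lengths.\<close>

lemma svd_perturbation_bound:
  assumes A: "A \<in> carrier_mat n d" and svd: "is_svd A U S V"
    and A': "A' \<in> carrier_mat l d" and svd': "is_svd A' U' S' V'"
  shows "\<bar>\<Sum>j<d. \<Sum>i<d. x j * (((sing_val S (Suc j))\<^sup>2 - (sing_val S' (Suc i))\<^sup>2)
        * (transpose_mat V * V') $$ (j, i)) * y i\<bar>
      \<le> op_norm (transpose_mat A * A - transpose_mat A' * A') * L2_set x {..<d} * L2_set y {..<d}"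
proof -
  let ?E = "transpose_mat A * A - transpose_mat A' * A'"
  define W where "W = transpose_mat V * V'"
  define D where "D = mat d d (\<lambda>(i, j). if i = j then (sing_val S (Suc i))\<^sup>2 else (0 :: real))"
  define D' where "D' = mat d d (\<lambda>(i, j). if i = j then (sing_val S' (Suc i))\<^sup>2 else (0 :: real))"
  have V: "V \<in> carrier_mat d d" "transpose_mat V * V = 1\<^sub>m d"
    and V': "V' \<in> carrier_mat d d" "transpose_mat V' * V' = 1\<^sub>m d"
    using A svd A' svd' by (auto simp: is_svd_def)
  have c: "W \<in> carrier_mat d d" "D \<in> carrier_mat d d" "D' \<in> carrier_mat d d" "?E \<in> carrier_mat d d"
    "transpose_mat A * A \<in> carrier_mat d d" "transpose_mat A' * A' \<in> carrier_mat d d"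
    using V V' A A' by (auto simp: W_def D_def D'_def)
  have "transpose_mat V * ?E * V' = transpose_mat V * (transpose_mat A * A) * V'
      - transpose_mat V * (transpose_mat A' * A' * V')"
    using V V' c by (simp add: mult_minus_distrib_mat[of _ d d _ d] minus_mult_distrib_mat[of _ d d _ _ d]
       assoc_mult_mat[of _ d d _ d _ d])
  also have "\<dots> = D * W - W * D'"
    unfolding svd_gram(1)[OF A' svd'] svd_gram(2)[OF A svd] D_def[symmetric] D'_def[symmetric] W_def
    using V V' c by (simp add: assoc_mult_mat[of _ d d _ d _ d])
  finally have G: "transpose_mat V * ?E * V' = D * W - W * D'" .
  have entry: "(D * W - W * D') $$ (j, i)
      = ((sing_val S (Suc j))\<^sup>2 - (sing_val S' (Suc i))\<^sup>2) * W $$ (j, i)" if "j < d" "i < d" for j i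
  proof -
    have "(D * W) $$ (j, i) = (\<Sum>m<d. D $$ (j, m) * W $$ (m, i))"
      using c that by (simp add: scalar_prod_def lessThan_atLeast0)
    also have "\<dots> = (\<Sum>m<d. if m = j then (sing_val S (Suc j))\<^sup>2 * W $$ (j, i) else 0)"
      using that by (intro sum.cong) (auto simp: D_def)
    finally have 1: "(D * W) $$ (j, i) = (sing_val S (Suc j))\<^sup>2 * W $$ (j, i)" using that by simp
    have "(W * D') $$ (j, i) = (\<Sum>m<d. W $$ (j, m) * D' $$ (m, i))"
      using c that by (simp add: scalar_prod_def lessThan_atLeast0)
    also have "\<dots> = (\<Sum>m<d. if m = i then W $$ (j, i) * (sing_val S' (Suc i))\<^sup>2 else 0)"
      using that by (intro sum.cong) (auto simp: D'_def)
    finally have 2: "(W * D') $$ (j, i) = W $$ (j, i) * (sing_val S' (Suc i))\<^sup>2" using that by simp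
    have "(D * W - W * D') $$ (j, i) = (D * W) $$ (j, i) - (W * D') $$ (j, i)"
      using c that by (intro index_minus_mat) auto
    then show ?thesis unfolding 1 2 by (simp add: algebra_simps)
  qed
  define u where "u = vec d x"
  define v where "v = vec d y"
  have u: "u \<in> carrier_vec d" and v: "v \<in> carrier_vec d" by (auto simp: u_def v_def)
  have "(\<Sum>j<d. \<Sum>i<d. x j * (((sing_val S (Suc j))\<^sup>2 - (sing_val S' (Suc i))\<^sup>2) * W $$ (j, i)) * y i)
      = u \<bullet> ((D * W - W * D') *\<^sub>v v)"
  proof -
    have "((D * W - W * D') *\<^sub>v v) $ j
        = (\<Sum>i<d. ((sing_val S (Suc j))\<^sup>2 - (sing_val S' (Suc i))\<^sup>2) * W $$ (j, i) * y i)" if "j < d" for j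
    proof -
      have "((D * W - W * D') *\<^sub>v v) $ j = (\<Sum>i<d. (D * W - W * D') $$ (j, i) * v $ i)"
        using that c v by (simp add: scalar_prod_def lessThan_atLeast0)
      then show ?thesis using that by (simp add: entry v_def del: index_minus_mat)
    qed
    moreover have "u \<bullet> ((D * W - W * D') *\<^sub>v v) = (\<Sum>j<d. x j * ((D * W - W * D') *\<^sub>v v) $ j)"
      using c by (simp add: scalar_prod_def u_def lessThan_atLeast0 del: index_mult_mat_vec)
    ultimately show ?thesis by (simp add: sum_distrib_left ac_simps)
  qed
  also have "\<dots> = (V *\<^sub>v u) \<bullet> (?E *\<^sub>v (V' *\<^sub>v v))"
  proof -
    have "(D * W - W * D') *\<^sub>v v = transpose_mat V *\<^sub>v (?E *\<^sub>v (V' *\<^sub>v v))"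
      unfolding G[symmetric] using V V' c v
      by (simp add: assoc_mult_mat_vec[of _ d d _ d])
    then show ?thesis
      using transpose_vec_mult_scalar[OF V(1) u, of "?E *\<^sub>v (V' *\<^sub>v v)"] V V' c u v
      by (simp add: comm_scalar_prod[of _ d])
  qed
  finally have eq: "(\<Sum>j<d. \<Sum>i<d. x j * (((sing_val S (Suc j))\<^sup>2 - (sing_val S' (Suc i))\<^sup>2)
      * W $$ (j, i)) * y i) = (V *\<^sub>v u) \<bullet> (?E *\<^sub>v (V' *\<^sub>v v))" .
  have "\<bar>(V *\<^sub>v u) \<bullet> (?E *\<^sub>v (V' *\<^sub>v v))\<bar> \<le> l2_norm (V *\<^sub>v u) * l2_norm (?E *\<^sub>v (V' *\<^sub>v v))"
    using V c by (intro abs_scalar_prod_le_l2_norm) auto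
  also have "\<dots> \<le> l2_norm (V *\<^sub>v u) * (op_norm ?E * l2_norm (V' *\<^sub>v v))"
    using V' c v by (intro mult_left_mono l2_norm_mult_mat_vec_le l2_norm_nonneg) auto
  also have "l2_norm (V *\<^sub>v u) = L2_set x {..<d}"
    unfolding l2_norm_isometry[OF V u] by (auto simp: l2_norm_eq_L2_set u_def intro!: L2_set_cong)
  also have "l2_norm (V' *\<^sub>v v) = L2_set y {..<d}"
    unfolding l2_norm_isometry[OF V' v] by (auto simp: l2_norm_eq_L2_set v_def intro!: L2_set_cong)
  finally show ?thesis unfolding eq[symmetric] W_def by (simp add: ac_simps)
qed

text \<open>The subtracted term is the squared norm of \<open>transpose_mat F *\<^sub>v a\<close>,
  whose entries are the first \<open>k\<close> coordinates of \<open>a\<close> in the basis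
  \<open>V\<close>. In a difference of two such distances \<open>(l2_norm a)\<^sup>2\<close>
  cancels.\<close>

lemma proj_dist_eq:
  assumes V: "V \<in> carrier_mat d d" and a: "a \<in> carrier_vec d" and k: "k \<le> d"
  shows "proj_dist V k a = (l2_norm a)\<^sup>2 - (\<Sum>j<k. ((transpose_mat V *\<^sub>v a) $ j)\<^sup>2)"
proof -
  define F where "F = first_cols V k"
  have F: "F \<in> carrier_mat d k" using V by (auto simp: F_def first_cols_def)
  have c: "transpose_mat F *\<^sub>v a \<in> carrier_vec k" using F a by simp
  have "(1\<^sub>m d - F * transpose_mat F) *\<^sub>v a = a - F *\<^sub>v (transpose_mat F *\<^sub>v a)"
    using F a by (simp add: minus_mult_distrib_mat_vec[of _ d d] assoc_mult_mat_vec[of _ d k _ d])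
  then have "proj_dist V k a = a \<bullet> (a - F *\<^sub>v (transpose_mat F *\<^sub>v a))"
    using V by (simp add: proj_dist_def F_def)
  also have "\<dots> = a \<bullet> a - a \<bullet> (F *\<^sub>v (transpose_mat F *\<^sub>v a))"
    using F a c by (intro scalar_prod_minus_distrib[of _ d]) auto
  also have "a \<bullet> (F *\<^sub>v (transpose_mat F *\<^sub>v a))
      = (transpose_mat F *\<^sub>v a) \<bullet> (transpose_mat F *\<^sub>v a)"
    using transpose_vec_mult_scalar[OF F c a] by simp
  also have "\<dots> = (\<Sum>j<k. ((transpose_mat F *\<^sub>v a) $ j)\<^sup>2)"
    using F by (simp add: scalar_prod_def power2_eq_square lessThan_atLeast0)
  also have "\<dots> = (\<Sum>j<k. ((transpose_mat V *\<^sub>v a) $ j)\<^sup>2)"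
    using V F k a by (intro sum.cong) (auto simp: F_def first_cols_def scalar_prod_def)
  finally show ?thesis by (simp add: l2_norm_sq)
qed

lemma sing_val_sq_antimono:
  assumes A: "A \<in> carrier_mat n d" and svd: "is_svd A U S V" and ij: "i \<le> j" "j < d"
  shows "(sing_val S (Suc j))\<^sup>2 \<le> (sing_val S (Suc i))\<^sup>2"
proof (cases "j < n")
  case True
  have S: "S \<in> carrier_mat n d" "S $$ (j, j) \<ge> 0" "S $$ (j, j) \<le> S $$ (i, i)"
    using A svd ij True by (auto simp: is_svd_def)
  then show ?thesis using ij True by (auto simp: sing_val_def intro: power_mono)
next
  \<comment> \<open>Beyond the diagonal the left side is the square of the default value 0.\<close>
  case False
  have "S \<in> carrier_mat n d" using A svd by (auto simp: is_svd_def)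
  then show ?thesis using False by (auto simp: sing_val_def)
qed

lemma orthogonal_mat_entries:
  fixes W :: "real mat"
  assumes W: "W \<in> carrier_mat d d" and eq: "transpose_mat W * W = 1\<^sub>m d" and jm: "j < d" "m < d"
  shows "(\<Sum>i<d. W $$ (i, j) * W $$ (i, m)) = (if j = m then 1 else 0)"
proof -
  have "(transpose_mat W * W) $$ (j, m) = (\<Sum>i<d. W $$ (i, j) * W $$ (i, m))"
    using W jm by (simp add: scalar_prod_def lessThan_atLeast0)
  then show ?thesis unfolding eq using jm by simp
qed

section \<open>The bound for a row of \<open>A\<close>\<close>

theorem theorem7:
  fixes A A' U S V U' S' V' :: "real mat"
    and n d l k :: nat
    and \<Delta> \<epsilon> \<mu> :: real
  assumes A: "A \<in> carrier_mat n d"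
    and svd: "is_svd A U S V"
    and pos: "sing_val S d > 0"
    and k: "1 \<le> k" "k < d"
    and \<Delta>: "\<Delta> > 0"
    and sep: "separated S k \<Delta>"
    and \<epsilon>: "0 < \<epsilon>" "\<epsilon> < 1/3"
    and A': "A' \<in> carrier_mat l d"
    and svd': "is_svd A' U' S' V'"
    and \<mu>: "\<mu> = \<epsilon>\<^sup>2 * \<Delta>"
    and approx: "op_norm (transpose_mat A * A - transpose_mat A' * A') \<le> \<mu> * (sing_val S 1)\<^sup>2"
  shows "\<forall>i<n. \<bar>proj_dist V k (row A i) - proj_dist V' k (row A i)\<bar>
                 \<le> \<epsilon> * (l2_norm (row A i))\<^sup>2"
proof (intro allI impI)
  fix r assume r: "r < n"
  define a where "a = row A r"
  define W where "W = transpose_mat V * V'"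
  \<comment> \<open>\<open>g\<close> is the guaranteed gap of the squared singular values, and
    \<delta> equals \<open>\<mu> * (sing_val S 1)\<^sup>2\<close>, the assumed bound on the
    perturbation.\<close>
  define g where "g = \<Delta> * (sing_val S 1)\<^sup>2"
  define \<delta> where "\<delta> = \<epsilon>\<^sup>2 * g"
  have V: "V \<in> carrier_mat d d" "transpose_mat V * V = 1\<^sub>m d"
    and V': "V' \<in> carrier_mat d d" "transpose_mat V' * V' = 1\<^sub>m d"
    using A svd A' svd' by (auto simp: is_svd_def)
  \<comment> \<open>For square matrices a left inverse is also a right inverse, so the rows of
    \<open>V\<close> and \<open>V'\<close> are orthonormal too.\<close>
  note VV = mat_mult_left_right_inverse[OF _ V(1) V(2)] mat_mult_left_right_inverse[OF _ V'(1) V'(2)]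
  have VVT: "V * transpose_mat V = 1\<^sub>m d" "V' * transpose_mat V' = 1\<^sub>m d"
    using V V' by (auto intro: VV)
  have a: "a \<in> carrier_vec d" using A r by (auto simp: a_def)
  have W: "W \<in> carrier_mat d d" using V V' by (simp add: W_def)
  have WT: "transpose_mat W = transpose_mat V' * V"
    unfolding W_def using V V' by (simp add: transpose_mult[of _ d d _ d])
  have WWT: "W * transpose_mat W = 1\<^sub>m d"
  proof -
    have "W * transpose_mat W = transpose_mat V * (V' * transpose_mat V') * V"
      unfolding WT unfolding W_def using V V' by (simp add: assoc_mult_mat[of _ d d _ d _ d])
    then show ?thesis using V VVT by simp
  qed
  then have WTW: "transpose_mat W * W = 1\<^sub>m d"
    using W by (intro mat_mult_left_right_inverse[of W]) auto
  define p where "p j = (transpose_mat V *\<^sub>v a) $ j" for j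
  define q where "q j = (transpose_mat V' *\<^sub>v a) $ j" for j
  \<comment> \<open>Inserting \<open>V' * transpose_mat V'\<close> shows that \<open>W\<close>
    converts coordinates in the basis \<open>V'\<close> into coordinates in the basis
    \<open>V\<close>; its transpose converts back.\<close>
  have pq: "transpose_mat V *\<^sub>v a = W *\<^sub>v (transpose_mat V' *\<^sub>v a)"
  proof -
    have "W *\<^sub>v (transpose_mat V' *\<^sub>v a) = transpose_mat V *\<^sub>v ((V' * transpose_mat V') *\<^sub>v a)"
      unfolding W_def using V V' a by (simp add: assoc_mult_mat_vec[of _ d d _ d])
    then show ?thesis using a VVT by simp
  qed
  have qp: "transpose_mat V' *\<^sub>v a = transpose_mat W *\<^sub>v (transpose_mat V *\<^sub>v a)"
  proof -
    have "transpose_mat W *\<^sub>v (transpose_mat V *\<^sub>v a) = transpose_mat V' *\<^sub>v ((V * transpose_mat V) *\<^sub>v a)"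
      unfolding WT using V V' a by (simp add: assoc_mult_mat_vec[of _ d d _ d])
    then show ?thesis using a VVT by simp
  qed
  have p: "p j = (\<Sum>i<d. W $$ (j, i) * q i)" if "j < d" for j
  proof -
    have "(W *\<^sub>v w) $ j = (\<Sum>i<d. W $$ (j, i) * w $ i)" if "w \<in> carrier_vec d" for w
      using that \<open>j < d\<close> W by (simp add: scalar_prod_def lessThan_atLeast0)
    from this[of "transpose_mat V' *\<^sub>v a"] show ?thesis unfolding p_def pq q_def using mult_mat_vec_carrier[of "transpose_mat V'" d d a] V' a by auto
  qed
  have q: "q i = (\<Sum>j<d. W $$ (j, i) * p j)" if "i < d" for i
  proof -
    have "(transpose_mat W *\<^sub>v w) $ i = (\<Sum>j<d. W $$ (j, i) * w $ j)" if "w \<in> carrier_vec d" for w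
      using that \<open>i < d\<close> W by (simp add: scalar_prod_def lessThan_atLeast0)
    from this[of "transpose_mat V *\<^sub>v a"] show ?thesis unfolding q_def qp p_def using mult_mat_vec_carrier[of "transpose_mat V" d d a] V a by auto
  qed
  \<comment> \<open>Positivity of the last singular value passes to the first, hence to
    \<open>g\<close>.\<close>
  have "sing_val S d \<le> sing_val S 1"
  proof (rule power2_le_imp_le)
    show "(sing_val S d)\<^sup>2 \<le> (sing_val S 1)\<^sup>2"
      using sing_val_sq_antimono[OF A svd, of 0 "d - 1"] k by simp
    have "S \<in> carrier_mat n d" using A svd by (auto simp: is_svd_def)
    then show "0 \<le> sing_val S 1" using A svd by (auto simp: is_svd_def sing_val_def)
  qed
  then have "0 < g" using pos \<Delta> by (simp add: g_def)
  have norm_eq: "L2_set (($) (transpose_mat X *\<^sub>v a)) {..<d} = l2_norm a"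
    if "X \<in> carrier_mat d d" "X * transpose_mat X = 1\<^sub>m d" for X
    using l2_norm_isometry[of "transpose_mat X" d d a] that a by (simp add: l2_norm_eq_L2_set)
  have pn: "L2_set p {..<d} = l2_norm a" and qn: "L2_set q {..<d} = l2_norm a"
    using norm_eq[OF V(1) VVT(1)] norm_eq[OF V'(1) VVT(2)] unfolding p_def q_def by auto
  have "\<epsilon>\<^sup>2 < 1" using \<epsilon> by (simp add: abs_square_less_1)
  then have \<delta>: "0 \<le> \<delta>" "\<delta> < g" using \<open>0 < g\<close> by (auto simp: \<delta>_def)
  have "\<bar>proj_dist V k a - proj_dist V' k a\<bar> = \<bar>(\<Sum>j<k. (p j)\<^sup>2) - (\<Sum>i<k. (q i)\<^sup>2)\<bar>"
    using proj_dist_eq[OF V(1) a, of k] proj_dist_eq[OF V'(1) a, of k] k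
    by (simp add: p_def q_def)
  also have "\<dots> \<le> 2 * (\<delta> / (g - \<delta>)) * L2_set p {..<d} * L2_set q {..<d}"
  \<comment> \<open>\<open>sing_val\<close> counts from 1 and the sums from 0, hence
    \<open>Suc\<close>; the gap between \<open>k - 1\<close> and \<open>k\<close> is then exactly
    the one in \<open>separated\<close>.\<close>
  proof (rule projection_difference_bound[where W = "\<lambda>j i. W $$ (j, i)"
        and \<alpha> = "\<lambda>j. (sing_val S (Suc j))\<^sup>2" and \<beta> = "\<lambda>j. (sing_val S' (Suc j))\<^sup>2"])
    show "(\<Sum>i<d. W $$ (j, i) * W $$ (m, i)) = (if j = m then 1 else 0)" if "j < d" "m < d" for j m
      using orthogonal_mat_entries[of "transpose_mat W" d j m] that W WWT by simp
    show "(\<Sum>i<d. W $$ (i, j) * W $$ (i, m)) = (if j = m then 1 else 0)" if "j < d" "m < d" for j m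
      using orthogonal_mat_entries[OF W WTW] that by simp
    show "\<bar>\<Sum>j<d. \<Sum>i<d. x j * (((sing_val S (Suc j))\<^sup>2 - (sing_val S' (Suc i))\<^sup>2) * W $$ (j, i)) * y i\<bar>
        \<le> \<delta> * L2_set x {..<d} * L2_set y {..<d}" for x y
      using svd_perturbation_bound[OF A svd A' svd', of x y] approx
        mult_right_mono[of _ \<delta> "L2_set x {..<d} * L2_set y {..<d}"]
      by (fastforce simp: W_def \<delta>_def g_def \<mu> mult.assoc)
    show "g \<le> (sing_val S (Suc (k - 1)))\<^sup>2 - (sing_val S (Suc k))\<^sup>2"
      using sep k by (simp add: separated_def g_def)
  qed (use sing_val_sq_antimono[OF A svd] sing_val_sq_antimono[OF A' svd'] k \<delta> in
      \<open>(auto intro: p q)\<close>)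
  also have "\<dots> = 2 * (\<delta> / (g - \<delta>)) * (l2_norm a)\<^sup>2"
    unfolding pn qn by (simp add: power2_eq_square)
  also have "\<dots> \<le> \<epsilon> * (l2_norm a)\<^sup>2"
  proof (intro mult_right_mono)
    \<comment> \<open>After cancelling \<open>g\<close> the claim is
      \<open>2 * \<epsilon> \<le> 1 - \<epsilon>\<^sup>2\<close>; from
      \<open>\<epsilon> < 1/3\<close> the left side is below 2/3 and the right side at least
      2/3.\<close>
    have "\<epsilon> * \<epsilon> \<le> 1/3 * 1" using \<epsilon> by (intro mult_mono) auto
    then have "\<epsilon> * (2 * \<epsilon>) \<le> \<epsilon> * (1 - \<epsilon>\<^sup>2)"
      using \<epsilon> by (intro mult_left_mono) (auto simp: power2_eq_square)
    then have "2 * \<epsilon>\<^sup>2 / (1 - \<epsilon>\<^sup>2) \<le> \<epsilon>"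
      using \<open>\<epsilon>\<^sup>2 < 1\<close> by (simp add: divide_le_eq power2_eq_square)
    moreover have "\<delta> / (g - \<delta>) = \<epsilon>\<^sup>2 / (1 - \<epsilon>\<^sup>2)"
    proof -
      have "\<delta> / (g - \<delta>) = (\<epsilon>\<^sup>2 * g) / ((1 - \<epsilon>\<^sup>2) * g)" by (simp add: \<delta>_def algebra_simps)
      then show ?thesis using \<open>0 < g\<close> by simp
    qed
    ultimately show "2 * (\<delta> / (g - \<delta>)) \<le> \<epsilon>" by simp
  qed simp
  finally show "\<bar>proj_dist V k (row A r) - proj_dist V' k (row A r)\<bar> \<le> \<epsilon> * (l2_norm (row A r))\<^sup>2"
    by (simp add: a_def)
qed

end
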